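(* There is a total function $f:\omega\to\omega$ that is approximable from above and is $1$-complete within the class of all total functions approximable from above; that is, for every total function $h$ approximable from above there is a total computable injective $d$ with $h=f\circ d$.
   Context: A total function is approximable from above if it equals $x\mapsto\lim_s g(x,s)$ for a total computable $g$ with $g(x,s+1)\le g(x,s)$ for all $x,s$. *)

theory Defs
  imports Complex_Main
begin

text \<open>
  Partial recursive functions in Kleene's sense, as terms with a big-step evaluation relation;
  \<open>evaluates e xs y\<close> means that the function denoted by \<open>e\<close> is defined
  on the argument tuple \<open>xs\<close> with value \<open>y\<close>. Terms carry no arity: on tuples of a fixed
  length \<open>k\<close> a term denotes a \<open>k\<close>-ary partial recursive function, undefined
  wherever the lengths do not fit.
\<close>

datatype recfn =
    Zero
  | Succ
  | Proj nat
  | Comp recfn "recfn list"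
  | PrimRec recfn recfn
  | Mu recfn

inductive evaluates :: "recfn \<Rightarrow> nat list \<Rightarrow> nat \<Rightarrow> bool" where
  Zero: "evaluates Zero xs 0"
| Succ: "evaluates Succ [x] (Suc x)"
| Proj: "i < length xs \<Longrightarrow> evaluates (Proj i) xs (xs ! i)"
| Comp: "list_all2 (\<lambda>g y. evaluates g xs y) gs ys \<Longrightarrow> evaluates f ys z
         \<Longrightarrow> evaluates (Comp f gs) xs z"
| PrimRec_0: "evaluates f xs y \<Longrightarrow> evaluates (PrimRec f g) (0 # xs) y"
| PrimRec_Suc: "evaluates (PrimRec f g) (n # xs) r \<Longrightarrow> evaluates g (n # r # xs) y
         \<Longrightarrow> evaluates (PrimRec f g) (Suc n # xs) y"
| Mu: "evaluates f (n # xs) 0 \<Longrightarrow> \<forall>m<n. \<exists>y. evaluates f (m # xs) (Suc y)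
         \<Longrightarrow> evaluates (Mu f) xs n"

definition computable :: "(nat \<Rightarrow> nat) \<Rightarrow> bool" where
  "computable d \<longleftrightarrow> (\<exists>e. \<forall>x. evaluates e [x] (d x))"

definition computable2 :: "(nat \<Rightarrow> nat \<Rightarrow> nat) \<Rightarrow> bool" where
  "computable2 g \<longleftrightarrow> (\<exists>e. \<forall>x s. evaluates e [x, s] (g x s))"

text \<open>The limit is taken in the discrete topology on \<^typ>\<open>nat\<close>.\<close>

definition approximable_from_above :: "(nat \<Rightarrow> nat) \<Rightarrow> bool" where
  "approximable_from_above h \<longleftrightarrow>
     (\<exists>g. computable2 g \<and> (\<forall>x s. g x (Suc s) \<le> g x s) \<and> (\<forall>x. (\<lambda>s. g x s) \<longlonglongrightarrow> h x))"

definition one_reducible :: "(nat \<Rightarrow> nat) \<Rightarrow> (nat \<Rightarrow> nat) \<Rightarrow> bool" where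
  "one_reducible h f \<longleftrightarrow> (\<exists>d. computable d \<and> inj d \<and> h = f \<circ> d)"

definition one_complete_within :: "((nat \<Rightarrow> nat) \<Rightarrow> bool) \<Rightarrow> (nat \<Rightarrow> nat) \<Rightarrow> bool" where
  "one_complete_within C f \<longleftrightarrow> C f \<and> (\<forall>h. C h \<longrightarrow> one_reducible h f)"

end

theory Submission
  imports Defs "HOL-Library.Nat_Bijection"
begin

text \<open>
  Let \<open>f\<close> take the triple of \<open>e\<close>, \<open>x\<close>, \<open>b\<close> to the minimum of \<open>b\<close> and all values of the binary
  partial recursive function with index \<open>e\<close> on arguments \<open>(x, t)\<close>. Dovetailing the computations
  approximates \<open>f\<close> from above, and the default value \<open>b\<close> keeps \<open>f\<close> total without having to decide
  convergence. If a total \<open>g\<close> with index \<open>e\<close> decreases to \<open>h\<close>, then \<open>h x\<close> is the value of \<open>f\<close>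
  at the triple of \<open>e\<close>, \<open>x\<close>, \<open>g x 0\<close>, which is computable and injective in \<open>x\<close>.

  Dovetailing needs a universal machine. Since non-total indices may be treated arbitrarily, it only
  has to be complete: a deterministic stack machine that reaches the value of every
  terminating evaluation suffices, and no converse is needed.
\<close>

section \<open>Closure properties of computable functions\<close>

text \<open>\<open>env\<close> lists the numerical arguments that are presented to the recursive function, so that
  unary and binary functions share the closure rules.\<close>

definition computable_at :: "('a \<Rightarrow> nat list) \<Rightarrow> ('a \<Rightarrow> nat) \<Rightarrow> bool" where
  "computable_at env F \<longleftrightarrow> (\<exists>e. \<forall>x. evaluates e (env x) (F x))"

abbreviation (input) "unary_env \<equiv> \<lambda>x::nat. [x]"
abbreviation (input) "binary_env \<equiv> \<lambda>p::nat \<times> nat. [fst p, snd p]"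

lemma computable_iff_at: "computable f \<longleftrightarrow> computable_at unary_env f"
  by (simp add: computable_def computable_at_def)

lemma computable2_iff_at:
  "computable2 g \<longleftrightarrow> computable_at binary_env (\<lambda>p. g (fst p) (snd p))"
  by (simp add: computable2_def computable_at_def)

lemma computable_at_Proj:
  assumes "\<And>x. i < length (env x) \<and> env x ! i = F x"
  shows "computable_at env F"
  unfolding computable_at_def using assms evaluates.Proj by metis

lemma computable_at_ident: "computable_at unary_env (\<lambda>x. x)"
  by (rule computable_at_Proj[of 0]) simp

lemma computable_at_fst: "computable_at binary_env fst"
  by (rule computable_at_Proj[of 0]) simp

lemma computable_at_snd: "computable_at binary_env snd"
  by (rule computable_at_Proj[of 1]) simp

lemma computable_at_comp1:
  assumes "computable f" "computable_at env a"
  shows "computable_at env (\<lambda>x. f (a x))"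
proof -
  obtain e e' where "\<And>y. evaluates e [y] (f y)" "\<And>x. evaluates e' (env x) (a x)"
    using assms unfolding computable_def computable_at_def by blast
  then have "evaluates (Comp e [e']) (env x) (f (a x))" for x
    by (intro evaluates.Comp[where ys = "[a x]"]) auto
  then show ?thesis unfolding computable_at_def by blast
qed

lemma computable_at_comp2:
  assumes "computable2 g" "computable_at env a" "computable_at env b"
  shows "computable_at env (\<lambda>x. g (a x) (b x))"
proof -
  obtain e e1 e2 where "\<And>y z. evaluates e [y, z] (g y z)"
    "\<And>x. evaluates e1 (env x) (a x)" "\<And>x. evaluates e2 (env x) (b x)"
    using assms unfolding computable2_def computable_at_def by blast
  then have "evaluates (Comp e [e1, e2]) (env x) (g (a x) (b x))" for x
    by (intro evaluates.Comp[where ys = "[a x, b x]"]) auto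
  then show ?thesis unfolding computable_at_def by blast
qed

lemma computable_Suc: "computable Suc"
  unfolding computable_def using evaluates.Succ by blast

lemmas computable_at_Suc = computable_at_comp1[OF computable_Suc]

lemma computable_at_const: "computable_at env (\<lambda>_. n)"
proof (induction n)
  case 0
  show ?case unfolding computable_at_def using evaluates.Zero by blast
next
  case (Suc n)
  then show ?case by (rule computable_at_Suc)
qed

text \<open>Without parameters the base case is evaluated on the empty tuple, where
  \<open>recfn.Zero\<close> is available; hence the start value 0.\<close>

lemma computable_rec_nat:
  assumes "computable2 g"
  shows "computable (rec_nat 0 g)"
proof -
  obtain e where e: "\<And>n r. evaluates e [n, r] (g n r)"
    using assms unfolding computable2_def by blast
  have "evaluates (PrimRec recfn.Zero e) [n] (rec_nat 0 g n)" for n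
    by (induction n) (auto intro: evaluates.intros e)
  then show ?thesis unfolding computable_def by blast
qed

text \<open>Iteration is the form in which recursion with a parameter is used below: whatever the
  recursion needs is packed into the one number being iterated.\<close>

lemma computable2_funpow:
  assumes "computable f"
  shows "computable2 (\<lambda>n x. (f ^^ n) x)"
proof -
  obtain e where e: "\<And>x. evaluates e [x] (f x)"
    using assms unfolding computable_def by blast
  have step: "evaluates (Comp e [Proj (Suc 0)]) [n, r, x] (f r)" for n r x
    using evaluates.Proj[of "Suc 0" "[n, r, x]"] by (intro evaluates.Comp[where ys = "[r]"] e) auto
  have base: "evaluates (Proj 0) [x] x" for x
    using evaluates.Proj[of 0 "[x]"] by simp
  have "evaluates (PrimRec (Proj 0) (Comp e [Proj (Suc 0)])) [n, x] ((f ^^ n) x)" for n x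
    by (induction n) (auto intro: evaluates.PrimRec_0 evaluates.PrimRec_Suc base step)
  then show ?thesis unfolding computable2_def by blast
qed

lemma computable_Least:
  assumes "computable2 P" and total: "\<And>x. \<exists>n. P n x = 0"
  shows "computable (\<lambda>x. LEAST n. P n x = 0)"
proof -
  obtain e where e: "\<And>n x. evaluates e [n, x] (P n x)"
    using assms unfolding computable2_def by blast
  have "evaluates (Mu e) [x] (LEAST n. P n x = 0)" for x
  proof (rule evaluates.Mu)
    show "evaluates e ((LEAST n. P n x = 0) # [x]) 0"
      using e LeastI_ex[OF total] by metis
    show "\<forall>m<LEAST n. P n x = 0. \<exists>y. evaluates e (m # [x]) (Suc y)"
      using e not_less_Least not0_implies_Suc by metis
  qed
  then show ?thesis unfolding computable_def by blast
qed

lemma computable_at_if_zero: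
  assumes "computable_at env c" "computable_at env a" "computable_at env b"
  shows "computable_at env (\<lambda>x. if c x = 0 then a x else b x)"
proof -
  obtain e1 e2 e3 where e: "\<And>x. evaluates e1 (env x) (c x)"
    "\<And>x. evaluates e2 (env x) (a x)" "\<And>x. evaluates e3 (env x) (b x)"
    using assms unfolding computable_at_def by blast
  have base: "evaluates (Proj 0) [u, v] u" for u v
    using evaluates.Proj[of 0 "[u, v]"] by simp
  have step: "evaluates (Proj 3) [n, r, u, v] v" for n r u v
    using evaluates.Proj[of 3 "[n, r, u, v]"] by simp
  \<comment> \<open>Case distinction as a recursion that discards its previous value.
    \<open>Comp\<close> evaluates both branches first, which is harmless since both are
    total.\<close>
  have "evaluates (PrimRec (Proj 0) (Proj 3)) [n, u, v] (if n = 0 then u else v)" for n u v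
    by (induction n) (auto intro: evaluates.PrimRec_0 evaluates.PrimRec_Suc base step)
  then have "evaluates (Comp (PrimRec (Proj 0) (Proj 3)) [e1, e2, e3]) (env x)
      (if c x = 0 then a x else b x)" for x
    by (intro evaluates.Comp[where ys = "[c x, a x, b x]"]) (auto simp: e)
  then show ?thesis unfolding computable_at_def by blast
qed

lemma computable_at_add:
  assumes "computable_at env a" "computable_at env b"
  shows "computable_at env (\<lambda>x. a x + b x)"
proof -
  have "(Suc ^^ n) x = n + x" for n x
    by (induction n) auto
  then show ?thesis
    using computable_at_comp2[OF computable2_funpow[OF computable_Suc] assms] by simp
qed

lemma computable_at_diff:
  assumes "computable_at env a" "computable_at env b"
  shows "computable_at env (\<lambda>x. a x - b x)"
proof -
  have "computable2 (\<lambda>n r. n)"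
    using computable_at_fst by (simp add: computable2_iff_at)
  then have "computable (rec_nat 0 (\<lambda>n r. n))"
    by (rule computable_rec_nat)
  moreover have "rec_nat 0 (\<lambda>n r. n) = (\<lambda>x::nat. x - 1)"
    by (rule ext, rename_tac x, case_tac x) auto
  ultimately have pred: "computable (\<lambda>x. x - 1)"
    by simp
  have "((\<lambda>x::nat. x - 1) ^^ n) x = x - n" for n x
    by (induction n) auto
  then show ?thesis
    using computable_at_comp2[OF computable2_funpow[OF pred] assms(2,1)] by simp
qed

lemma computable_at_min:
  assumes "computable_at env a" "computable_at env b"
  shows "computable_at env (\<lambda>x. min (a x) (b x))"
proof -
  have "min m n = m - (m - n)" for m n :: nat
    by simp
  then show ?thesis
    using assms by (simp only: computable_at_diff)
qed

lemma computable_at_if_eq: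
  assumes "computable_at env c" "computable_at env d" "computable_at env a" "computable_at env b"
  shows "computable_at env (\<lambda>x. if c x = d x then a x else b x)"
proof -
  have "computable_at env (\<lambda>x. if (c x - d x) + (d x - c x) = 0 then a x else b x)"
    by (intro computable_at_if_zero computable_at_add computable_at_diff assms)
  moreover have "(c x - d x) + (d x - c x) = 0 \<longleftrightarrow> c x = d x" for x
    by auto
  ultimately show ?thesis
    by (simp only:)
qed

section \<open>Pairs and lists\<close>

definition pair :: "nat \<Rightarrow> nat \<Rightarrow> nat" where
  "pair m n = prod_encode (m, n)"

definition pfst :: "nat \<Rightarrow> nat" where
  "pfst z = fst (prod_decode z)"

definition psnd :: "nat \<Rightarrow> nat" where
  "psnd z = snd (prod_decode z)"

definition cons :: "nat \<Rightarrow> nat \<Rightarrow> nat" where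
  "cons m n = Suc (pair m n)"

definition chd :: "nat \<Rightarrow> nat" where
  "chd z = pfst (z - 1)"

definition ctl :: "nat \<Rightarrow> nat" where
  "ctl z = psnd (z - 1)"

lemma pfst_pair [simp]: "pfst (pair m n) = m"
  and psnd_pair [simp]: "psnd (pair m n) = n"
  by (simp_all add: pair_def pfst_def psnd_def)

lemma pair_collapse [simp]: "pair (pfst z) (psnd z) = z"
  by (simp add: pair_def pfst_def psnd_def)

lemma chd_cons [simp]: "chd (cons m n) = m"
  and ctl_cons [simp]: "ctl (cons m n) = n"
  and cons_neq_0 [simp]: "cons m n \<noteq> 0"
  by (simp_all add: cons_def chd_def ctl_def)

text \<open>Keeps list codes in terms of \<open>cons\<close>, so that the simplifier can execute
  \<open>step\<close> symbolically.\<close>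

lemma list_encode_Cons [simp]: "list_encode (x # xs) = cons x (list_encode xs)"
  by (simp add: cons_def pair_def)

declare list_encode.simps(2) [simp del]

section \<open>Computability of the Cantor pairing and its projections\<close>

lemma computable_triangle: "computable triangle"
proof -
  have "computable2 (\<lambda>n r. r + Suc n)"
    unfolding computable2_iff_at
    by (intro computable_at_add computable_at_Suc computable_at_fst computable_at_snd)
  then have "computable (rec_nat 0 (\<lambda>n r. r + Suc n))"
    by (rule computable_rec_nat)
  moreover have "rec_nat 0 (\<lambda>n r. r + Suc n) n = triangle n" for n
    by (induction n) auto
  ultimately show ?thesis
    by (metis (no_types, lifting) ext)
qed

lemmas computable_at_triangle = computable_at_comp1[OF computable_triangle]

lemma computable_at_pair:
  assumes "computable_at env a" "computable_at env b"
  shows "computable_at env (\<lambda>x. pair (a x) (b x))"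
  unfolding pair_def prod_encode_def
  using assms by (simp add: computable_at_add computable_at_triangle)

text \<open>The index of the antidiagonal containing \<open>z\<close>, found by search; the
  truncated difference vanishes exactly when \<open>z < triangle (Suc n)\<close>.\<close>

definition diagonal :: "nat \<Rightarrow> nat" where
  "diagonal z = (LEAST n. Suc z - triangle (Suc n) = 0)"

lemma triangle_mono: "m \<le> n \<Longrightarrow> triangle m \<le> triangle n"
  unfolding triangle_def by (intro div_le_mono mult_le_mono) auto

lemma diagonal_pair: "diagonal (pair m n) = m + n"
  unfolding diagonal_def
proof (rule Least_equality)
  show "Suc (pair m n) - triangle (Suc (m + n)) = 0"
    by (simp add: pair_def prod_encode_def)
  fix k assume "Suc (pair m n) - triangle (Suc k) = 0"
  then have "triangle (m + n) < triangle (Suc k)"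
    by (simp add: pair_def prod_encode_def)
  then show "m + n \<le> k"
    using triangle_mono[of "Suc k" "m + n"] by linarith
qed

text \<open>The code of \<open>(m, n)\<close> is \<open>triangle (m + n) + m\<close>, and
  \<open>diagonal\<close> recovers \<open>m + n\<close>.\<close>

lemma pfst_eq: "pfst z = z - triangle (diagonal z)"
proof -
  have "pfst (pair m n) = pair m n - triangle (diagonal (pair m n))" for m n
    by (simp only: pfst_pair diagonal_pair) (simp add: pair_def prod_encode_def)
  from this[of "pfst z" "psnd z"] show ?thesis by simp
qed

lemma psnd_eq: "psnd z = diagonal z - pfst z"
proof -
  have "psnd (pair m n) = diagonal (pair m n) - pfst (pair m n)" for m n
    by (simp add: diagonal_pair)
  from this[of "pfst z" "psnd z"] show ?thesis by simp
qed

lemma computable_diagonal: "computable diagonal"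
  unfolding diagonal_def
proof (rule computable_Least)
  show "computable2 (\<lambda>n z. Suc z - triangle (Suc n))"
    unfolding computable2_iff_at
    by (intro computable_at_diff computable_at_triangle computable_at_Suc
        computable_at_fst computable_at_snd)
  fix z
  have "Suc z \<le> triangle (Suc z)"
    by simp
  then show "\<exists>n. Suc z - triangle (Suc n) = 0"
    by (metis diff_is_0_eq)
qed

lemma computable_at_pfst:
  assumes "computable_at env a"
  shows "computable_at env (\<lambda>x. pfst (a x))"
  unfolding pfst_eq
  by (intro computable_at_diff computable_at_triangle computable_at_comp1[OF computable_diagonal] assms)

lemma computable_at_psnd:
  assumes "computable_at env a"
  shows "computable_at env (\<lambda>x. psnd (a x))"
  unfolding psnd_eq
  by (intro computable_at_diff computable_at_pfst computable_at_comp1[OF computable_diagonal] assms)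

lemma computable_at_cons:
  assumes "computable_at env a" "computable_at env b"
  shows "computable_at env (\<lambda>x. cons (a x) (b x))"
  unfolding cons_def by (intro computable_at_Suc computable_at_pair assms)

lemma computable_at_chd:
  assumes "computable_at env a"
  shows "computable_at env (\<lambda>x. chd (a x))"
  unfolding chd_def by (intro computable_at_pfst computable_at_diff computable_at_const assms)

lemma computable_at_ctl:
  assumes "computable_at env a"
  shows "computable_at env (\<lambda>x. ctl (a x))"
  unfolding ctl_def by (intro computable_at_psnd computable_at_diff computable_at_const assms)

lemmas computable_at_intros = computable_at_ident computable_at_const computable_at_Suc
  computable_at_diff computable_at_min computable_at_if_eq computable_at_pair
  computable_at_pfst computable_at_psnd computable_at_cons computable_at_chd computable_at_ctl

lemma computable2_if_uncurried:
  assumes "computable (\<lambda>z. g (pfst z) (psnd z))"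
  shows "computable2 g"
  using computable_at_comp1[OF assms computable_at_pair[OF computable_at_fst computable_at_snd]]
  by (simp add: computable2_iff_at)

section \<open>A universal stack machine\<close>

text \<open>
  A state is a pair of a register \<open>v\<close>, holding the last value returned, and a stack of
  instructions; it is final when the stack is empty. An instruction is a pair of an argument list
  and an operation. The operations are the codes of recursive functions, where \<open>Comp\<close> also carries
  the inner values computed so far and \<open>Mu\<close> the current candidate, and three continuations: tag 4
  stores the value of an inner function of a composition, tag 6 performs the recursion step of a
  primitive recursion, tag 8 tests the candidate of a minimisation. The inner functions of a
  composition are stored in reverse order, so that consing their values yields the right order.
\<close>

fun code :: "recfn \<Rightarrow> nat" where
  "code recfn.Zero = list_encode [0]"
| "code Succ = list_encode [1]"
| "code (Proj i) = list_encode [2, i]"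
| "code (Comp f gs) = list_encode [3, code f, list_encode (map code (rev gs)), 0]"
| "code (PrimRec f g) = list_encode [5, code f, code g]"
| "code (Mu f) = list_encode [7, code f, 0]"

definition step :: "nat \<Rightarrow> nat" where
  "step s =
    (let v = pfst s; stack = psnd s; K = ctl stack; xs = pfst (chd stack); t = psnd (chd stack);
       tag = chd t; a = chd (ctl t); b = chd (ctl (ctl t)); c = chd (ctl (ctl (ctl t)))
     in if stack = 0 then s
     else if tag = 0 then pair 0 K
     else if tag = 1 then pair (Suc (chd xs)) K
     else if tag = 2 then
       (if a = 0 then pair (chd xs) K
        else pair v (cons (pair (ctl xs) (cons 2 (cons (a - 1) 0))) K))
     else if tag = 3 then
       (if b = 0 then pair v (cons (pair c a) K)
        else pair v (cons (pair xs (chd b))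
               (cons (pair xs (cons 4 (cons a (cons (ctl b) (cons c 0))))) K)))
     else if tag = 4 then pair v (cons (pair xs (cons 3 (cons a (cons b (cons (cons v c) 0))))) K)
     else if tag = 5 then
       (if chd xs = 0 then pair v (cons (pair (ctl xs) a) K)
        else pair v (cons (pair (cons (chd xs - 1) (ctl xs)) t)
               (cons (pair (ctl xs) (cons 6 (cons b (cons (chd xs - 1) 0)))) K)))
     else if tag = 6 then pair v (cons (pair (cons b (cons v xs)) a) K)
     else if tag = 7 then
       pair v (cons (pair (cons b xs) a) (cons (pair xs (cons 8 (cons a (cons b 0)))) K))
     else
       (if v = 0 then pair b K else pair v (cons (pair xs (cons 7 (cons a (cons (Suc b) 0)))) K)))"

lemma computable_step: "computable step"
  unfolding computable_iff_at step_def Let_def by (intro computable_at_intros)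

section \<open>Simulation of terminating evaluations\<close>

definition reaches :: "nat \<Rightarrow> nat \<Rightarrow> bool" where
  "reaches s s' \<longleftrightarrow> (\<exists>n. (step ^^ n) s = s')"

lemma reaches_refl: "reaches s s"
  unfolding reaches_def by (metis funpow_0)

lemma reaches_trans [trans]: "reaches s s' \<Longrightarrow> reaches s' s'' \<Longrightarrow> reaches s s''"
  unfolding reaches_def by (metis add.commute comp_apply funpow_add)

lemma reaches_step: "reaches (step s) s' \<Longrightarrow> reaches s s'"
  unfolding reaches_def by (metis comp_apply funpow_Suc_right)

text \<open>Final states are fixed points of \<open>step\<close>, so two runs that both end in one
  agree after the sum of their lengths.\<close>

lemma reaches_final_unique:
  assumes "reaches s s'" "psnd s' = 0" "psnd ((step ^^ k) s) = 0"
  shows "(step ^^ k) s = s'"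
proof -
  have fixed: "(step ^^ i) u = u" if "psnd u = 0" for u i
    using that by (induction i) (auto simp: step_def)
  obtain n where n: "(step ^^ n) s = s'"
    using assms(1) unfolding reaches_def by blast
  have "(step ^^ (k + n)) s = s'"
    using fixed[OF assms(2), of k] n by (simp add: funpow_add)
  moreover have "(step ^^ (n + k)) s = (step ^^ k) s"
    using fixed[OF assms(3), of n] by (simp add: funpow_add)
  ultimately show ?thesis
    by (simp add: add.commute)
qed

abbreviation "eval_state v e xs K \<equiv> pair v (cons (pair (list_encode xs) (code e)) K)"

text \<open>Generalized over the accumulator \<open>zs\<close>, onto which each value is consed,
  whence \<open>rev ys\<close>. The register \<open>w\<close> ends up with the last value returned,
  or with \<open>v\<close> if there is none.\<close>

lemma reaches_Comp_args:
  assumes "list_all2 (\<lambda>g y. \<forall>v K. reaches (eval_state v g xs K) (pair y K)) gs ys"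
  shows "\<exists>w. reaches
    (pair v (cons (pair (list_encode xs)
       (list_encode [3, a, list_encode (map code gs), list_encode zs])) K))
    (pair w (cons (pair (list_encode xs)
       (list_encode [3, a, 0, list_encode (rev ys @ zs)])) K))"
  using assms
proof (induction arbitrary: v zs rule: list_all2_induct)
  case Nil
  show ?case by (auto intro: reaches_refl)
next
  case (Cons g gs y ys)
  let ?S = "\<lambda>v gs zs. pair v (cons (pair (list_encode xs)
       (list_encode [3, a, list_encode (map code gs), list_encode zs])) K)"
  let ?F = "cons (pair (list_encode xs)
       (list_encode [4, a, list_encode (map code gs), list_encode zs])) K"
  have "reaches (?S v (g # gs) zs) (eval_state v g xs ?F)"
    by (rule reaches_step) (simp add: step_def Let_def reaches_refl)
  also have "reaches (eval_state v g xs ?F) (pair y ?F)"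
    using Cons by blast
  also have "reaches (pair y ?F) (?S y gs (y # zs))"
    by (rule reaches_step) (simp add: step_def Let_def reaches_refl)
  finally show ?case
    using Cons.IH[of y "y # zs"] reaches_trans by auto
qed

text \<open>By induction on the evaluation, for all \<open>v\<close> and \<open>K\<close>, since
  subcomputations start with other registers and on deeper stacks.\<close>

lemma reaches_evaluates:
  assumes "evaluates e xs y"
  shows "reaches (eval_state v e xs K) (pair y K)"
  using assms
proof (induction arbitrary: v K rule: evaluates.induct)
  case (Zero xs)
  show ?case
    by (rule reaches_step) (simp add: step_def Let_def reaches_refl)
next
  case (Succ x)
  show ?case
    by (rule reaches_step) (simp add: step_def Let_def reaches_refl)
next
  case (Proj i xs)
  then show ?case
  proof (induction i arbitrary: xs)
    case 0
    then obtain x xs' where "xs = x # xs'" by (cases xs) auto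
    then show ?case
      by - (rule reaches_step, simp add: step_def Let_def reaches_refl)
  next
    case (Suc i)
    then obtain x xs' where "xs = x # xs'" by (cases xs) auto
    with Suc show ?case
      by - (rule reaches_step, simp add: step_def Let_def reaches_refl)
  qed
next
  case (Comp xs gs ys f z)
  \<comment> \<open>\<open>code\<close> stores the inner functions reversed, so the accumulated list
    comes out as \<open>ys\<close>.\<close>
  have "list_all2 (\<lambda>g y. \<forall>v K. reaches (eval_state v g xs K) (pair y K)) (rev gs) (rev ys)"
    using Comp(1) by (auto elim: list_all2_mono simp: list_all2_rev)
  from reaches_Comp_args[OF this, of v "code f" "[]" K] obtain w where
    "reaches (eval_state v (Comp f gs) xs K)
      (pair w (cons (pair (list_encode xs) (list_encode [3, code f, 0, list_encode ys])) K))"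
    by auto
  also have "reaches \<dots> (eval_state w f ys K)"
    by (rule reaches_step) (simp add: step_def Let_def reaches_refl)
  also have "reaches \<dots> (pair z K)"
    by (rule Comp.IH)
  finally show ?case .
next
  case (PrimRec_0 f xs y g)
  show ?case
    by (rule reaches_step)
      (use PrimRec_0 in \<open>simp add: step_def Let_def\<close>)
next
  case (PrimRec_Suc f g n xs r y)
  let ?F = "cons (pair (list_encode xs) (list_encode [6, code g, n])) K"
  have "reaches (eval_state v (PrimRec f g) (Suc n # xs) K)
      (eval_state v (PrimRec f g) (n # xs) ?F)"
    by (rule reaches_step) (simp add: step_def Let_def reaches_refl)
  also have "reaches \<dots> (pair r ?F)"
    by (rule PrimRec_Suc.IH)
  also have "reaches \<dots> (eval_state r g (n # r # xs) K)"
    by (rule reaches_step) (simp add: step_def Let_def reaches_refl)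
  also have "reaches \<dots> (pair y K)"
    by (rule PrimRec_Suc.IH)
  finally show ?case .
next
  case (Mu f n xs)
  let ?S = "\<lambda>v m. pair v (cons (pair (list_encode xs) (list_encode [7, code f, m])) K)"
  let ?F = "\<lambda>m. cons (pair (list_encode xs) (list_encode [8, code f, m])) K"
  have start: "reaches (?S v m) (eval_state v f (m # xs) (?F m))" for v m
    by (rule reaches_step) (simp add: step_def Let_def reaches_refl)
  \<comment> \<open>Every candidate below \<open>n\<close> yields a successor, so the test with tag
    8 moves on to the next one.\<close>
  have "m \<le> n \<Longrightarrow> \<exists>w. reaches (?S v 0) (?S w m)" for m
  proof (induction m)
    case 0
    show ?case using reaches_refl by blast
  next
    case (Suc m)
    then obtain w where "reaches (?S v 0) (?S w m)" by auto
    also note start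
    also obtain u where "reaches (eval_state w f (m # xs) (?F m)) (pair (Suc u) (?F m))"
      using Mu.IH(2) Suc.prems by (meson Suc_le_lessD)
    also have "reaches (pair (Suc u) (?F m)) (?S (Suc u) (Suc m))"
      by (rule reaches_step) (simp add: step_def Let_def reaches_refl)
    finally show ?case by blast
  qed
  then obtain w where "reaches (?S v 0) (?S w n)" by blast
  also note start
  also have "reaches (eval_state w f (n # xs) (?F n)) (pair 0 (?F n))"
    by (rule Mu.IH)
  also have "reaches (pair 0 (?F n)) (pair n K)"
    by (rule reaches_step) (simp add: step_def Let_def reaches_refl)
  finally show ?case by simp
qed

definition run :: "nat \<Rightarrow> nat \<Rightarrow> nat \<Rightarrow> nat \<Rightarrow> nat" where
  "run e x t k = (step ^^ k) (pair 0 (cons (pair (cons x (cons t 0)) e) 0))"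

text \<open>The second part is where determinism enters: on a convergent input any halted state must
  be the one already known to be reached.\<close>

lemma run_code:
  assumes "evaluates e [x, t] y"
  shows "\<exists>k. run (code e) x t k = pair y 0"
    and "psnd (run (code e) x t k) = 0 \<Longrightarrow> run (code e) x t k = pair y 0"
proof -
  have r: "reaches (pair 0 (cons (pair (cons x (cons t 0)) (code e)) 0)) (pair y 0)"
    using reaches_evaluates[OF assms, of 0 0] by simp
  then show "\<exists>k. run (code e) x t k = pair y 0"
    by (simp add: reaches_def run_def)
  show "psnd (run (code e) x t k) = 0 \<Longrightarrow> run (code e) x t k = pair y 0"
    using reaches_final_unique[OF r] by (simp add: run_def)
qed

section \<open>The complete function\<close>

text \<open>At stage \<open>s\<close>, the pair of \<open>t\<close> and \<open>k\<close>, the machine is run for \<open>k\<close> steps on \<open>(x, t)\<close>.\<close>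

definition candidate :: "nat \<Rightarrow> nat \<Rightarrow> nat" where
  "candidate n s =
    (let r = run (pfst n) (pfst (psnd n)) (pfst s) (psnd s)
     in if psnd r = 0 then pfst r else psnd (psnd n))"

primrec approx :: "nat \<Rightarrow> nat \<Rightarrow> nat" where
  "approx n 0 = psnd (psnd n)"
| "approx n (Suc s) = min (approx n s) (candidate n s)"

lemma computable_at_candidate:
  assumes "computable_at env a" "computable_at env b"
  shows "computable_at env (\<lambda>x. candidate (a x) (b x))"
  unfolding candidate_def run_def Let_def
  by (intro computable_at_intros computable_at_comp2[OF computable2_funpow[OF computable_step]] assms)

text \<open>The recursion is turned into an iteration on triples of \<open>n\<close>, the stage and
  the current value.\<close>

lemma computable2_approx: "computable2 approx"
proof -
  let ?next = "\<lambda>z. pair (pfst z) (pair (Suc (pfst (psnd z)))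
    (min (psnd (psnd z)) (candidate (pfst z) (pfst (psnd z)))))"
  have "computable ?next"
    unfolding computable_iff_at by (intro computable_at_intros computable_at_candidate)
  note iter = computable_at_comp2[OF computable2_funpow[OF this]]
  have "(?next ^^ s) (pair n (pair 0 (psnd (psnd n)))) = pair n (pair s (approx n s))" for n s
    by (induction s) auto
  then have "approx n s = psnd (psnd ((?next ^^ s) (pair n (pair 0 (psnd (psnd n))))))" for n s
    by simp
  then show ?thesis
    by (intro computable2_if_uncurried)
      (simp only: computable_iff_at, intro iter computable_at_intros)
qed

definition complete_fn :: "nat \<Rightarrow> nat" where
  "complete_fn n = Inf (range (approx n))"

text \<open>The infimum is attained by well-ordering, and from there on the sequence is
  constant.\<close>

lemma decseq_nat_tendsto_Inf:
  fixes u :: "nat \<Rightarrow> nat"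
  assumes "decseq u"
  shows "u \<longlonglongrightarrow> Inf (range u)"
proof -
  have "Inf (range u) \<in> range u"
    by (rule Inf_nat_def1) simp
  then obtain N where N: "u N = Inf (range u)"
    by (metis rangeE)
  have "u s = Inf (range u)" if "N \<le> s" for s
    using decseqD[OF assms that] N by (simp add: antisym cInf_lower)
  then show ?thesis
    by (intro tendsto_eventually eventually_sequentiallyI)
qed

lemma approximable_from_above_complete_fn: "approximable_from_above complete_fn"
  unfolding approximable_from_above_def complete_fn_def
  by (intro exI[of _ approx] conjI computable2_approx allI decseq_nat_tendsto_Inf)
    (auto intro: decseq_SucI)

text \<open>No stage can fall below the infimum, as all values, the default \<open>u 0\<close>
  included, lie in the range of \<open>u\<close>. Some stage gets down to it, since the infimum is
  some \<open>u t\<close> whose computation halts.\<close>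

lemma complete_fn_eq:
  assumes e: "\<And>t. evaluates e [x, t] (u t)"
    and "decseq u"
  shows "complete_fn (pair (code e) (pair x (u 0))) = Inf (range u)"
proof -
  let ?n = "pair (code e) (pair x (u 0))"
  have candidate: "candidate ?n s \<in> range u" for s
    using run_code(2)[OF e[of "pfst s"], of "psnd s"] by (auto simp: candidate_def Let_def)
  have approx: "approx ?n s \<in> range u" for s
    by (induction s) (use candidate in \<open>auto simp: min_def\<close>)
  obtain t where t: "u t = Inf (range u)"
    by (metis Inf_nat_def1 empty_not_UNIV image_is_empty rangeE)
  obtain k where "run (code e) x t k = pair (u t) 0"
    using run_code(1)[OF e] by blast
  then have "candidate ?n (pair t k) = u t"
    by (simp add: candidate_def)
  \<comment> \<open>The candidate of stage \<open>s\<close> enters the minimum only at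
    \<open>Suc s\<close>.\<close>
  then have "approx ?n (Suc (pair t k)) \<le> u t"
    by simp
  then have "Inf (range (approx ?n)) \<le> Inf (range u)"
    unfolding t by (meson cInf_lower bdd_below_bot order_trans rangeI)
  moreover have "Inf (range u) \<le> Inf (range (approx ?n))"
    by (rule cInf_superset_mono) (use approx in auto)
  ultimately show ?thesis
    by (simp add: complete_fn_def)
qed

lemma one_reducible_complete_fn:
  assumes "approximable_from_above h"
  shows "one_reducible h complete_fn"
proof -
  obtain g where g: "computable2 g" "\<And>x. decseq (g x)" "\<And>x. g x \<longlonglongrightarrow> h x"
    using assms unfolding approximable_from_above_def by (auto simp: decseq_Suc_iff)
  obtain e where e: "\<And>x t. evaluates e [x, t] (g x t)"
    using g(1) unfolding computable2_def by blast
  let ?d = "\<lambda>x. pair (code e) (pair x (g x 0))"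
  have "h x = Inf (range (g x))" for x
    using LIMSEQ_unique[OF g(3) decseq_nat_tendsto_Inf[OF g(2)]] .
  then have "h = complete_fn \<circ> ?d"
    using complete_fn_eq[OF e g(2)] by auto
  moreover have "inj ?d"
    by (rule injI) (metis pfst_pair psnd_pair)
  moreover have "computable ?d"
    unfolding computable_iff_at by (intro computable_at_intros computable_at_comp2[OF g(1)])
  ultimately show ?thesis
    unfolding one_reducible_def by blast
qed

theorem theorem3p9:
  "\<exists>f :: nat \<Rightarrow> nat. approximable_from_above f \<and> one_complete_within approximable_from_above f"
  unfolding one_complete_within_def
  using approximable_from_above_complete_fn one_reducible_complete_fn by blast

end
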